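(* Let $\mathrm{Coup}(E)$ be a connected coupling graph on $[n]$, $n\ge3$, and $\Gamma=(Q,C)$ a quantum circuit with $n$ qubits and $m\ge1$ gates. The number of orbitals of $D^0$ under the action of $G_X$ is $$|D^0/G_X|=\frac{\sum_{\tau\in\mathbb{S}_n}|B_\tau|}{2^p\, f!\cdot|\mathrm{Aut}(\mathrm{Coup}(E))|},$$ and for every $k\in[m]$ the number of orbitals of $D^k$ under the action of $G_X$ is $$|D^k/G_X|=\frac{\sum_{\tau\in F^k}|B_\tau|}{2^p\, f!\cdot|\mathrm{Aut}(\mathrm{Coup}(E))|}.$$
   Context: Notation: $[n]=\{1,\dots,n\}$; $\mathbb{S}_n$ is the symmetric group on $[n]$; products are compositions; $\tau^{-1}(S)=\{\tau^{-1}(s):s\in S\}$. Coupling graph: a simple undirected connected graph $\mathrm{Coup}(E)=([n],E)$. Qubits $Q=\{q_1,\dots,q_n\}$ are identified with $[n]$; a gate is a two-element subset of $Q$; a quantum circuit is $\Gamma=(Q,C)$ with $C=(g^1,\dots,g^m)$ a sequence of gates. $F^k=\{\tau\in\mathbb{S}_n:\tau^{-1}(g^k)\in E\}$ for $k\in[m]$. Fixing pattern: the gate graph $(Q,U)$ has vertex set $Q$ and edge set $U=\{g:g\in C\}$. The fixing pattern $\mathcal{F}=\{S_1,\dots,S_l\}$ is the partition of $Q$ whose parts are: each singleton consisting of a qubit in a connected component of $(Q,U)$ of size at least 3; each pair of qubits forming a connected component of size 2; and the set of all isolated vertices of $(Q,U)$ (the free set, if nonempty). $p$ is the number of such pairs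 and $f$ is the size of the free set. $\mathbb{S}_n(\mathcal{F})=\{a\in\mathbb{S}_n:a(S_i)=S_i\ \forall i\in[l]\}$. For $\tau\in\mathbb{S}_n$, $B_\tau=\{b\in\mathrm{Aut}(\mathrm{Coup}(E)):b(\tau^{-1}(S_i))=\tau^{-1}(S_i)\ \forall i\in[l]\}$. Let $s,t$ be two vertices and $V^k=\{\tau^k:\tau\in\mathbb{S}_n\}$, $k\in[m]$, disjoint copies of $\mathbb{S}_n$. The arc sets are $D^0=\{(s,\tau^1):\tau\in\mathbb{S}_n\}$, $D^k=\{(\tau^k,\tau^{k+1}):\tau\in F^k\}$ for $1\le k\le m-1$, and $D^m=\{(\tau^m,t):\tau\in F^m\}$. $G_X$ is the group of permutations fixing $s,t$ and mapping $\tau^k\mapsto(a\tau b^{-1})^k$ (for all $\tau\in\mathbb{S}_n$, $k\in[m]$) with $(a,b)\in\mathbb{S}_n(\mathcal{F})\times\mathrm{Aut}(\mathrm{Coup}(E))$; it acts on arcs by $\rho((u,v))=(\rho(u),\rho(v))$ and preserves each $D^k$. The orbitals of $D^k$ are the orbits of this action on $D^k$; their set is $D^k/G_X$. *)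

theory Defs
  imports Complex_Main "HOL-Algebra.Group_Action" "HOL-Algebra.Sym_Groups"
begin

text \<open>Permutations of \<open>{1..n}\<close> are total functions on \<open>nat\<close> that are the identity outside \<open>{1..n}\<close>,
  so that \<open>\<circ>\<close> and \<open>inv'\<close> are the operations of the symmetric group.\<close>

abbreviation Sym :: "nat \<Rightarrow> (nat \<Rightarrow> nat) set"
  where "Sym n \<equiv> carrier (sym_group n)"

definition simple_graph :: "'a set \<Rightarrow> 'a set set \<Rightarrow> bool"
  where "simple_graph V E \<longleftrightarrow> (\<forall>e\<in>E. e \<subseteq> V \<and> card e = 2)"

definition reach :: "'a set set \<Rightarrow> 'a rel"
  where "reach E = {(u, v). {u, v} \<in> E}\<^sup>*"

definition connected_graph :: "'a set \<Rightarrow> 'a set set \<Rightarrow> bool"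
  where "connected_graph V E \<longleftrightarrow> simple_graph V E \<and> (\<forall>u\<in>V. \<forall>v\<in>V. (u, v) \<in> reach E)"

definition component :: "'a set \<Rightarrow> 'a set set \<Rightarrow> 'a \<Rightarrow> 'a set"
  where "component V E v = {u \<in> V. (v, u) \<in> reach E}"

definition components :: "'a set \<Rightarrow> 'a set set \<Rightarrow> 'a set set"
  where "components V E = component V E ` V"

definition isolated_vertices :: "'a set \<Rightarrow> 'a set set \<Rightarrow> 'a set"
  where "isolated_vertices V E = {v \<in> V. \<forall>e\<in>E. v \<notin> e}"

definition graph_Aut :: "nat \<Rightarrow> nat set set \<Rightarrow> (nat \<Rightarrow> nat) set"
  where "graph_Aut n E =
    {b \<in> Sym n. \<forall>u\<in>{1..n}. \<forall>v\<in>{1..n}. {u, v} \<in> E \<longleftrightarrow> {b u, b v} \<in> E}"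

text \<open>A circuit on the qubits \<open>{1..n}\<close> is the list \<open>C\<close> of its gates; lists are indexed from 0,
  so the \<open>k\<close>-th gate (\<open>1 \<le> k \<le> length C\<close>) is \<open>C ! (k - 1)\<close>.
  The gate graph has vertex set \<open>{1..n}\<close> and edge set \<open>set C\<close>.\<close>

definition quantum_circuit :: "nat \<Rightarrow> nat set list \<Rightarrow> bool"
  where "quantum_circuit n C \<longleftrightarrow> (\<forall>g\<in>set C. g \<subseteq> {1..n} \<and> card g = 2)"

definition gate_alloc :: "nat \<Rightarrow> nat set set \<Rightarrow> nat set list \<Rightarrow> nat \<Rightarrow> (nat \<Rightarrow> nat) set"
  where "gate_alloc n E C k = {\<tau> \<in> Sym n. inv' \<tau> ` (C ! (k - 1)) \<in> E}"

definition pair_parts :: "nat \<Rightarrow> nat set list \<Rightarrow> nat set set"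
  where "pair_parts n C = {S \<in> components {1..n} (set C). card S = 2}"

definition free_set :: "nat \<Rightarrow> nat set list \<Rightarrow> nat set"
  where "free_set n C = isolated_vertices {1..n} (set C)"

definition fixing_pattern :: "nat \<Rightarrow> nat set list \<Rightarrow> nat set set"
  where "fixing_pattern n C =
    {{q} | q. q \<in> {1..n} \<and> card (component {1..n} (set C) q) \<ge> 3}
    \<union> pair_parts n C
    \<union> (if free_set n C = {} then {} else {free_set n C})"

definition Sym_pattern :: "nat \<Rightarrow> nat set set \<Rightarrow> (nat \<Rightarrow> nat) set"
  where "Sym_pattern n \<F> = {a \<in> Sym n. \<forall>S\<in>\<F>. a ` S = S}"

definition B_set :: "nat \<Rightarrow> nat set set \<Rightarrow> nat set list \<Rightarrow> (nat \<Rightarrow> nat) \<Rightarrow> (nat \<Rightarrow> nat) set"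
  where "B_set n E C \<tau> =
    {b \<in> graph_Aut n E. \<forall>S\<in>fixing_pattern n C. b ` (inv' \<tau> ` S) = inv' \<tau> ` S}"

text \<open>\<open>Layer k \<tau>\<close> is the copy of the permutation \<open>\<tau>\<close> in the \<open>k\<close>-th layer.\<close>

datatype vertex = Source | Sink | Layer nat "nat \<Rightarrow> nat"

definition vertices :: "nat \<Rightarrow> nat \<Rightarrow> vertex set"
  where "vertices n m = {Source, Sink} \<union> {Layer k \<tau> | k \<tau>. k \<in> {1..m} \<and> \<tau> \<in> Sym n}"

text \<open>The arc set with index \<open>k\<close>, meaningful for \<open>k \<le> length C\<close>.\<close>

definition arc_set :: "nat \<Rightarrow> nat set set \<Rightarrow> nat set list \<Rightarrow> nat \<Rightarrow> (vertex \<times> vertex) set"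
  where "arc_set n E C k =
    (if k = 0 then {(Source, Layer 1 \<tau>) | \<tau>. \<tau> \<in> Sym n}
     else if k < length C
       then {(Layer k \<tau>, Layer (k + 1) \<tau>) | \<tau>. \<tau> \<in> gate_alloc n E C k}
     else {(Layer k \<tau>, Sink) | \<tau>. \<tau> \<in> gate_alloc n E C k})"

definition G_X :: "nat \<Rightarrow> nat set set \<Rightarrow> nat set list \<Rightarrow> (vertex \<Rightarrow> vertex) monoid"
  where "G_X n E C = \<lparr>
    carrier = {\<rho>. \<rho> permutes vertices n (length C) \<and> \<rho> Source = Source \<and> \<rho> Sink = Sink \<and>
      (\<exists>a\<in>Sym_pattern n (fixing_pattern n C). \<exists>b\<in>graph_Aut n E.
        \<forall>k\<in>{1..length C}. \<forall>\<tau>\<in>Sym n. \<rho> (Layer k \<tau>) = Layer k (a \<circ> \<tau> \<circ> inv' b))},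
    monoid.mult = (\<circ>), one = id \<rparr>"

text \<open>Restricting to \<open>D\<close> makes each value extensional, as elements of \<open>BijGroup D\<close> are.\<close>

definition arc_action ::
    "(vertex \<times> vertex) set \<Rightarrow> (vertex \<Rightarrow> vertex) \<Rightarrow> vertex \<times> vertex \<Rightarrow> vertex \<times> vertex"
  where "arc_action D \<rho> = (\<lambda>(u, v)\<in>D. (\<rho> u, \<rho> v))"

definition orbitals ::
    "nat \<Rightarrow> nat set set \<Rightarrow> nat set list \<Rightarrow> nat \<Rightarrow> (vertex \<times> vertex) set set"
  where "orbitals n E C k =
    orbits (G_X n E C) (arc_set n E C k) (arc_action (arc_set n E C k))"

end

theory Submission
  imports Defs
begin

text \<open>
  When a finite group acts on a finite set, the stabilizers of the points of one orbit have sizes adding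
  up to the order of the group, so the number of orbits is the sum of all stabilizer sizes divided by
  the order of the group (\<open>sum_card_stabilizer\<close>). The formula is this statement for the product of the
  group of permutations preserving the fixing pattern with the automorphism group of the coupling
  graph, where \<open>(a, b)\<close> sends \<open>\<tau>\<close> to \<open>a \<circ> \<tau> \<circ> b\<inverse>\<close>.

  Three facts turn the general count into the stated one. First, \<open>(a, b)\<close> fixes \<open>\<tau>\<close> exactly if
  \<open>a = \<tau> \<circ> b \<circ> \<tau>\<inverse>\<close>, so the stabilizer of \<open>\<tau>\<close> is a copy of the set of those automorphisms \<open>b\<close> for
  which this conjugate preserves the pattern, and these form \<open>B_set\<close> at \<open>\<tau>\<close> (\<open>B_set_eq_conj\<close>). Second,
  the fixing pattern partitions the qubits, so a permutation preserving it amounts to an independent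
  choice of a permutation of each part: one choice for a singleton, two for a pair, \<open>f!\<close> for the free
  set (\<open>card_Sym_pattern\<close>). Third, each arc set is an injective image of a set of permutations, and
  the arc group moves arcs in the way the product moves permutations (\<open>orbit_G_X\<close>), so the
  orbitals correspond to the orbits of the product. For a layer carrying a gate this needs
  that the permutations routing the gate onto an edge are stable under the action; they are,
  because a permutation preserving the pattern maps every gate to itself
  (\<open>Sym_pattern_fixes_gates\<close>).
\<close>

section \<open>Orbit counting for two-sided multiplication\<close>

text \<open>Along an orbit the orbit-stabilizer theorem makes every stabilizer have order
  \<open>order G\<close> divided by the length of the orbit, so each orbit contributes \<open>order G\<close> to the sum.\<close>

lemma (in group_action) sum_card_stabilizer:
  assumes "finite (carrier G)" and "finite E"
  shows "(\<Sum>x\<in>E. card (stabilizer G \<phi> x)) = card (orbits G E \<phi>) * order G"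
proof -
  have "(\<Sum>x\<in>E. card (stabilizer G \<phi> x)) =
      (\<Sum>orb\<in>orbits G E \<phi>. \<Sum>x\<in>orb. card (stabilizer G \<phi> x))"
    by (rule disjoint_sum[OF assms(2), symmetric])
  also have "\<dots> = (\<Sum>orb\<in>orbits G E \<phi>. order G)"
    using card_stablizer_sum[OF assms(1)] by (intro sum.cong) auto
  finally show ?thesis by simp
qed

definition two_sided_group :: "('a, 'b) monoid_scheme \<Rightarrow> 'a set \<Rightarrow> 'a set \<Rightarrow> ('a \<times> 'a) monoid"
  where "two_sided_group G K L = G\<lparr>carrier := K\<rparr> \<times>\<times> G\<lparr>carrier := L\<rparr>"

text \<open>The inverse on the right factor makes this a left action of the product. Values are restricted to
  \<open>T\<close> because the carrier of \<open>BijGroup T\<close> contains only extensional functions.\<close>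

definition two_sided_action :: "('a, 'b) monoid_scheme \<Rightarrow> 'a set \<Rightarrow> 'a \<times> 'a \<Rightarrow> 'a \<Rightarrow> 'a"
  where "two_sided_action G T = (\<lambda>(a, b). \<lambda>t\<in>T. a \<otimes>\<^bsub>G\<^esub> t \<otimes>\<^bsub>G\<^esub> inv\<^bsub>G\<^esub> b)"

lemma (in group) two_sided_group_action:
  assumes K: "subgroup K G" and L: "subgroup L G" and T: "T \<subseteq> carrier G"
    and closed: "\<And>a b t. a \<in> K \<Longrightarrow> b \<in> L \<Longrightarrow> t \<in> T \<Longrightarrow> a \<otimes> t \<otimes> inv b \<in> T"
  shows "group_action (two_sided_group G K L) T (two_sided_action G T)"
proof -
  let ?H = "two_sided_group G K L" and ?f = "two_sided_action G T"
  have grp: "group ?H"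
    unfolding two_sided_group_def
    by (intro DirProd_group subgroup.subgroup_is_group K L group_axioms)
  note KL = subgroup.mem_carrier[OF K] subgroup.mem_carrier[OF L]
  have Tc: "\<And>t. t \<in> T \<Longrightarrow> t \<in> carrier G" using T by auto
  have bij: "?f (a, b) \<in> Bij T" if ab: "a \<in> K" "b \<in> L" for a b
  proof -
    have ab': "inv a \<in> K" "inv b \<in> L"
      using subgroup.m_inv_closed[OF K ab(1)] subgroup.m_inv_closed[OF L ab(2)] by simp_all
    have "bij_betw (\<lambda>t. a \<otimes> t \<otimes> inv b) T T"
    proof (rule bij_betwI[where g = "\<lambda>t. inv a \<otimes> t \<otimes> b"])
      show "(\<lambda>t. a \<otimes> t \<otimes> inv b) \<in> T \<rightarrow> T" using closed ab by auto
      show "(\<lambda>t. inv a \<otimes> t \<otimes> b) \<in> T \<rightarrow> T"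
        using closed[OF ab'] KL(2)[OF ab(2)] by auto
    next
      fix t assume "t \<in> T"
      then have t: "t \<in> carrier G" by (rule Tc)
      note c = t KL(1)[OF ab(1)] KL(2)[OF ab(2)]
      have "inv a \<otimes> (a \<otimes> t) = t" "a \<otimes> (inv a \<otimes> t) = t"
        using c by (simp_all flip: m_assoc)
      then show "inv a \<otimes> (a \<otimes> t \<otimes> inv b) \<otimes> b = t" "a \<otimes> (inv a \<otimes> t \<otimes> b) \<otimes> inv b = t"
        using c by (simp_all add: m_assoc)
    qed
    then have "bij_betw (?f (a, b)) T T"
      by (rule bij_betw_cong[THEN iffD1, rotated]) (simp add: two_sided_action_def)
    then show ?thesis by (simp add: Bij_def two_sided_action_def)
  qed
  have "?f \<in> hom ?H (BijGroup T)"
  proof (rule homI)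
    fix g assume "g \<in> carrier ?H"
    then show "?f g \<in> carrier (BijGroup T)"
      using bij by (auto simp: two_sided_group_def BijGroup_def)
  next
    fix g h assume g: "g \<in> carrier ?H" and h: "h \<in> carrier ?H"
    obtain a b c d where gh: "g = (a, b)" "h = (c, d)" by (metis surj_pair)
    have m: "a \<in> K" "b \<in> L" "c \<in> K" "d \<in> L"
      using g h by (auto simp: gh two_sided_group_def)
    note mc = KL(1)[OF m(1)] KL(2)[OF m(2)] KL(1)[OF m(3)] KL(2)[OF m(4)]
    have "?f (a \<otimes> c, b \<otimes> d) = compose T (?f (a, b)) (?f (c, d))"
    proof (rule extensionalityI)
      fix t assume t: "t \<in> T"
      show "?f (a \<otimes> c, b \<otimes> d) t = compose T (?f (a, b)) (?f (c, d)) t"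
        using t closed[OF m(3,4) t] Tc[OF t] mc
        by (simp add: two_sided_action_def compose_def m_assoc inv_mult_group)
    qed (auto simp: two_sided_action_def compose_def)
    then show "?f (g \<otimes>\<^bsub>?H\<^esub> h) = ?f g \<otimes>\<^bsub>BijGroup T\<^esub> ?f h"
      using bij m by (simp add: gh two_sided_group_def BijGroup_def)
  qed
  then show ?thesis
    unfolding group_action_def group_hom_def group_hom_axioms_def
    using grp group_BijGroup by blast
qed

text \<open>The equation \<open>a \<otimes> t \<otimes> inv b = t\<close> determines \<open>a\<close> from \<open>b\<close>, so a stabilizer is the graph of conjugation
  by \<open>t\<close> over those \<open>b\<close> whose conjugate lies in \<open>K\<close>.\<close>

lemma (in group) card_stabilizer_two_sided:
  assumes K: "subgroup K G" and L: "subgroup L G"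
    and T: "T \<subseteq> carrier G" and t: "t \<in> T"
  shows "card (stabilizer (two_sided_group G K L) (two_sided_action G T) t)
    = card {b \<in> L. t \<otimes> b \<otimes> inv t \<in> K}"
proof -
  have tc: "t \<in> carrier G" using T t by auto
  note KL = subgroup.mem_carrier[OF K] subgroup.mem_carrier[OF L]
  have eq: "a \<otimes> t \<otimes> inv b = t \<longleftrightarrow> a = t \<otimes> b \<otimes> inv t" if "a \<in> K" "b \<in> L" for a b
  proof -
    note c = tc KL(1)[OF that(1)] KL(2)[OF that(2)]
    have "a \<otimes> t \<otimes> inv b = t \<longleftrightarrow> a \<otimes> t = t \<otimes> b"
      using c by (metis inv_solve_right inv_closed m_closed)
    also have "\<dots> \<longleftrightarrow> a = t \<otimes> b \<otimes> inv t"
      using c by (metis inv_solve_right m_closed)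
    finally show ?thesis .
  qed
  have "stabilizer (two_sided_group G K L) (two_sided_action G T) t
      = (\<lambda>b. (t \<otimes> b \<otimes> inv t, b)) ` {b \<in> L. t \<otimes> b \<otimes> inv t \<in> K}"
    using t eq by (auto simp: stabilizer_def two_sided_group_def two_sided_action_def)
  then show ?thesis
    by (simp add: card_image inj_on_def)
qed

theorem (in group) card_two_sided_orbits:
  assumes K: "subgroup K G" and L: "subgroup L G" and T: "T \<subseteq> carrier G"
    and closed: "\<And>a b t. a \<in> K \<Longrightarrow> b \<in> L \<Longrightarrow> t \<in> T \<Longrightarrow> a \<otimes> t \<otimes> inv b \<in> T"
    and fin: "finite K" "finite L" "finite T"
  shows "card (orbits (two_sided_group G K L) T (two_sided_action G T)) * (card K * card L)
    = (\<Sum>t\<in>T. card {b \<in> L. t \<otimes> b \<otimes> inv t \<in> K})"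
proof -
  interpret A: group_action "two_sided_group G K L" T "two_sided_action G T"
    using two_sided_group_action[OF K L T closed] .
  have carr: "carrier (two_sided_group G K L) = K \<times> L"
    by (simp add: two_sided_group_def)
  show ?thesis
    using A.sum_card_stabilizer fin card_stabilizer_two_sided[OF K L T]
    by (simp add: carr order_def card_cartesian_product)
qed

section \<open>Permutations that preserve every part of a family\<close>

text \<open>A permutation preserving one more part \<open>S\<close> splits uniquely into its restriction to \<open>S\<close> and its restriction
  to the union of the other parts, each extended by the identity. Since the parts are disjoint, composing
  the two pieces recovers the permutation, and the count multiplies.\<close>

lemma card_permutes_preserving_parts:
  assumes "finite P" and "\<And>S. S \<in> P \<Longrightarrow> finite S" and "pairwise disjnt P"
  shows "card {a. a permutes \<Union>P \<and> (\<forall>S\<in>P. a ` S = S)} = (\<Prod>S\<in>P. fact (card S))"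
  using assms
proof (induction P rule: finite_induct)
  case empty
  have "{a::'a \<Rightarrow> 'a. a = id} = {id}" by auto
  then show ?case by simp
next
  case (insert S P)
  let ?U = "\<Union>P"
  let ?A = "{s. s permutes S}" and ?B = "{r. r permutes ?U \<and> (\<forall>S\<in>P. r ` S = S)}"
  let ?C = "{a. a permutes \<Union>(insert S P) \<and> (\<forall>S\<in>insert S P. a ` S = S)}"
  have dSR: "S \<inter> R = {}" if "R \<in> P" for R
    using insert.prems(2) insert.hyps(2) that by (auto simp: pairwise_insert disjnt_def)
  then have dSU: "S \<inter> ?U = {}" by auto
  have "bij_betw (\<lambda>(s, r). s \<circ> r) (?A \<times> ?B) ?C"
  proof (rule bij_betwI[where g = "\<lambda>a. (restrict_id a S, restrict_id a ?U)"])
    show "(\<lambda>(s, r). s \<circ> r) \<in> ?A \<times> ?B \<rightarrow> ?C"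
    proof
      fix x assume "x \<in> ?A \<times> ?B"
      then obtain s r where x: "x = (s, r)" and s: "s permutes S"
        and r: "r permutes ?U" and rP: "\<forall>R\<in>P. r ` R = R" by auto
      have "s permutes S \<union> ?U" "r permutes S \<union> ?U"
        using s r permutes_subset by blast+
      then have 1: "s \<circ> r permutes S \<union> ?U" using permutes_compose by blast
      have "r ` S = S" using permutes_not_in[OF r] dSU by (force simp: image_iff)
      then have 2: "(s \<circ> r) ` S = S"
        by (metis image_comp permutes_image s)
      have "s ` R = R" if "R \<in> P" for R
        using permutes_not_in[OF s] dSR[OF that] by (force simp: image_iff)
      then have 3: "\<forall>R\<in>P. (s \<circ> r) ` R = R"
        using rP by (metis image_comp)
      show "(\<lambda>(s, r). s \<circ> r) x \<in> ?C"
        using 1 2 3 by (simp add: x)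
    qed
    show "(\<lambda>a. (restrict_id a S, restrict_id a ?U)) \<in> ?C \<rightarrow> ?A \<times> ?B"
    proof
      fix a assume "a \<in> ?C"
      then have a: "a permutes S \<union> ?U" "a ` S = S" and aP: "\<forall>R\<in>P. a ` R = R" by auto
      have inj: "inj_on a X" for X using permutes_inj_on[OF a(1)] .
      have "a ` ?U = ?U" using aP by (simp add: image_Union)
      then have p: "restrict_id a S permutes S" "restrict_id a ?U permutes ?U"
        using a(2) inj by (auto intro!: permutes_restrict_id simp: bij_betw_def)
      have "restrict_id a ?U ` R = R" if "R \<in> P" for R
      proof -
        have "restrict_id a ?U ` R = a ` R"
          using that by (intro image_cong) (auto simp: restrict_id_def)
        then show ?thesis using aP that by simp
      qed
      with p show "(restrict_id a S, restrict_id a ?U) \<in> ?A \<times> ?B" by auto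
    qed
  next
    fix x assume "x \<in> ?A \<times> ?B"
    then obtain s r where x: "x = (s, r)" and s: "s permutes S" and r: "r permutes ?U"
      by auto
    have "restrict_id (s \<circ> r) S = s"
      using permutes_not_in[OF r] permutes_not_in[OF s] dSU
      by (fastforce simp: restrict_id_def fun_eq_iff)
    moreover have "restrict_id (s \<circ> r) ?U = r"
    proof
      fix y
      show "restrict_id (s \<circ> r) ?U y = r y"
      proof (cases "y \<in> ?U")
        case True
        then have "r y \<in> ?U" by (simp only: permutes_in_image[OF r])
        then have "r y \<notin> S" using dSU by auto
        then show ?thesis using True permutes_not_in[OF s] by (simp add: restrict_id_def)
      next
        case False
        then show ?thesis using permutes_not_in[OF r False] by (simp add: restrict_id_def)
      qed
    qed
    ultimately show "(\<lambda>a. (restrict_id a S, restrict_id a ?U)) ((\<lambda>(s, r). s \<circ> r) x) = x"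
      by (simp add: x)
  next
    fix a assume "a \<in> ?C"
    then have a: "a permutes S \<union> ?U" "a ` S = S" and aP: "\<forall>R\<in>P. a ` R = R" by auto
    have aU: "a ` ?U = ?U" using aP by (simp add: image_Union)
    have "restrict_id a S (restrict_id a ?U y) = a y" for y
    proof -
      consider "y \<in> S" | "y \<in> ?U" | "y \<notin> S \<union> ?U" by blast
      then show ?thesis
      proof cases
        case 1
        then have "y \<notin> ?U" using dSU by auto
        then show ?thesis using 1 by (simp add: restrict_id_def)
      next
        case 2
        then have "a y \<in> ?U" using aU by blast
        then have "a y \<notin> S" using dSU by auto
        then show ?thesis using 2 by (simp add: restrict_id_def)
      next
        case 3
        then show ?thesis using permutes_not_in[OF a(1) 3] by (simp add: restrict_id_def)
      qed
    qed
    then show "(\<lambda>(s, r). s \<circ> r) (restrict_id a S, restrict_id a ?U) = a"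
      by (simp add: fun_eq_iff)
  qed
  then have "card (?A \<times> ?B) = card ?C" by (rule bij_betw_same_card)
  then have "card ?C = card ?A * card ?B" unfolding card_cartesian_product by (rule sym)
  moreover have "card ?A = fact (card S)" using insert.prems(1) by (simp add: card_permutations)
  moreover have "card ?B = (\<Prod>S\<in>P. fact (card S))"
    by (rule insert.IH) (use insert.prems in \<open>simp_all add: pairwise_insert\<close>)
  ultimately show ?case using insert.hyps by simp
qed

section \<open>The fixing pattern\<close>

lemma reach_trans: "(u, v) \<in> reach E \<Longrightarrow> (v, w) \<in> reach E \<Longrightarrow> (u, w) \<in> reach E"
  unfolding reach_def by (rule rtrancl_trans)

lemma reach_sym: "(u, v) \<in> reach E \<Longrightarrow> (v, u) \<in> reach E"
proof -
  have "sym {(u, v). {u, v} \<in> E}" by (auto simp: sym_def insert_commute)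
  then show "(u, v) \<in> reach E \<Longrightarrow> (v, u) \<in> reach E"
    unfolding reach_def by (meson sym_rtrancl symD)
qed

lemma component_self: "v \<in> V \<Longrightarrow> v \<in> component V E v"
  by (simp add: component_def reach_def)

lemma component_eq: "u \<in> component V E v \<Longrightarrow> component V E u = component V E v"
  using reach_trans[of v u E] reach_trans[of u v E] reach_sym[of v u E]
  by (auto simp: component_def)

text \<open>Isolated vertices are defined through edges and the other parts through component sizes; this
  equivalence lets a single trichotomy on the size of a component classify all qubits.\<close>

lemma isolated_iff_component:
  assumes "simple_graph V E" and "v \<in> V"
  shows "v \<in> isolated_vertices V E \<longleftrightarrow> component V E v = {v}"
proof
  assume iso: "v \<in> isolated_vertices V E"
  have "u = v" if "(v, u) \<in> reach E" for u
    using that[unfolded reach_def]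
    by (cases rule: converse_rtranclE) (use iso in \<open>auto simp: isolated_vertices_def\<close>)
  then show "component V E v = {v}"
    using component_self[OF assms(2)] by (auto simp: component_def)
next
  assume comp: "component V E v = {v}"
  have False if e: "e \<in> E" "v \<in> e" for e
  proof -
    have "card e = 2" "e \<subseteq> V" using assms(1) e by (auto simp: simple_graph_def)
    then obtain w where w: "e = {v, w}" "w \<noteq> v" "w \<in> V"
      using e(2) by (auto simp: card_2_iff)
    then have "w \<in> component V E v" using e by (auto simp: component_def reach_def)
    then show False using comp w by auto
  qed
  then show "v \<in> isolated_vertices V E" using assms(2) by (auto simp: isolated_vertices_def)
qed

context
  fixes n :: nat and C :: "nat set list"
  assumes circuit: "quantum_circuit n C"
begin

abbreviation qubit_component :: "nat \<Rightarrow> nat set"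
  where "qubit_component \<equiv> component {1..n} (set C)"

text \<open>The part containing a qubit, read off from the size of its component. Describing the pattern as
  the image of this map (\<open>fixing_pattern_eq\<close>) reduces the partition property to \<open>part_of_self\<close> and
  \<open>part_of_eq\<close>.\<close>

definition part_of :: "nat \<Rightarrow> nat set"
  where "part_of q = (if card (qubit_component q) \<ge> 3 then {q}
    else if card (qubit_component q) = 2 then qubit_component q else free_set n C)"

lemma gate_graph_simple: "simple_graph {1..n} (set C)"
  using circuit by (simp add: simple_graph_def quantum_circuit_def)

lemma finite_qubit_component: "finite (qubit_component q)"
  by (simp add: component_def)

lemma free_set_iff:
  assumes "q \<in> {1..n}"
  shows "q \<in> free_set n C \<longleftrightarrow> card (qubit_component q) = 1"
  unfolding free_set_def isolated_iff_component[OF gate_graph_simple assms]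
  using component_self[OF assms, of "set C"] by (auto simp: card_1_singleton_iff)

lemma qubit_cases:
  assumes "q \<in> {1..n}"
  obtains "card (qubit_component q) \<ge> 3" | "card (qubit_component q) = 2" | "q \<in> free_set n C"
proof -
  have "card (qubit_component q) \<noteq> 0"
    using component_self[OF assms, of "set C"] finite_qubit_component by auto
  then show ?thesis using free_set_iff[OF assms] that by linarith
qed

lemma part_of_self: "q \<in> {1..n} \<Longrightarrow> q \<in> part_of q"
  using component_self[of q "{1..n}" "set C"] qubit_cases[of q] by (auto simp: part_of_def)

lemma free_set_subset: "free_set n C \<subseteq> {1..n}"
  by (auto simp: free_set_def isolated_vertices_def)

lemma part_of_subset: "q \<in> {1..n} \<Longrightarrow> part_of q \<subseteq> {1..n}"
  using free_set_subset by (auto simp: part_of_def component_def)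

lemma part_of_eq:
  assumes "q \<in> {1..n}" and "r \<in> part_of q"
  shows "part_of r = part_of q"
  using assms(1)
proof (cases rule: qubit_cases)
  case 1
  then show ?thesis using assms by (simp add: part_of_def)
next
  case 2
  then show ?thesis using assms component_eq[of r _ _ q] by (simp add: part_of_def)
next
  case 3
  then have q: "part_of q = free_set n C"
    using free_set_iff assms by (simp add: part_of_def)
  then have "r \<in> free_set n C" using assms by simp
  then show ?thesis using q free_set_iff[of r] free_set_subset by (auto simp: part_of_def)
qed

lemma fixing_pattern_eq: "fixing_pattern n C = part_of ` {1..n}"
proof
  show "part_of ` {1..n} \<subseteq> fixing_pattern n C"
  proof
    fix S assume "S \<in> part_of ` {1..n}"
    then obtain q where q: "q \<in> {1..n}" "S = part_of q" by blast
    show "S \<in> fixing_pattern n C"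
      using q(1)
    proof (cases rule: qubit_cases)
      case 1
      then have "S = {q}" using q by (simp add: part_of_def)
      then show ?thesis using q(1) 1 unfolding fixing_pattern_def by blast
    next
      case 2
      then have "S = qubit_component q" using q by (simp add: part_of_def)
      then have "S \<in> pair_parts n C" using q(1) 2 by (simp add: pair_parts_def components_def)
      then show ?thesis unfolding fixing_pattern_def by blast
    next
      case 3
      then have "S = free_set n C" "free_set n C \<noteq> {}"
        using q(2) 3 free_set_iff[OF q(1)] by (auto simp: part_of_def)
      then show ?thesis unfolding fixing_pattern_def by simp
    qed
  qed
  show "fixing_pattern n C \<subseteq> part_of ` {1..n}"
  proof
    fix S assume "S \<in> fixing_pattern n C"
    then have "S \<in> {{q} | q. q \<in> {1..n} \<and> card (qubit_component q) \<ge> 3} \<or> S \<in> pair_parts n C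
        \<or> S \<in> (if free_set n C = {} then {} else {free_set n C})"
      unfolding fixing_pattern_def by blast
    moreover have "S = free_set n C \<and> free_set n C \<noteq> {}"
      if "S \<in> (if free_set n C = {} then {} else {free_set n C})"
      using that by (cases "free_set n C = {}") simp_all
    ultimately consider q where "S = {q}" "q \<in> {1..n}" "card (qubit_component q) \<ge> 3"
      | "S \<in> pair_parts n C" | "S = free_set n C" "free_set n C \<noteq> {}"
      by blast
    then have "\<exists>q\<in>{1..n}. S = part_of q"
    proof cases
      case 1
      then have "S = part_of q" by (simp add: part_of_def)
      then show ?thesis using 1 by blast
    next
      case 2
      then obtain q where "q \<in> {1..n}" "S = qubit_component q" "card S = 2"
        unfolding pair_parts_def components_def by blast
      then have "S = part_of q" by (simp add: part_of_def)
      then show ?thesis using \<open>q \<in> {1..n}\<close> by blast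
    next
      case 3
      then obtain q where q: "q \<in> free_set n C" by blast
      then have "q \<in> {1..n}" using free_set_subset by auto
      moreover have "part_of q = free_set n C"
        using free_set_iff[OF calculation] q by (simp add: part_of_def)
      ultimately show ?thesis using 3 by blast
    qed
    then show "S \<in> part_of ` {1..n}" by blast
  qed
qed

lemma Union_fixing_pattern: "\<Union>(fixing_pattern n C) = {1..n}"
  unfolding fixing_pattern_eq using part_of_self part_of_subset by blast

lemma disjoint_fixing_pattern: "pairwise disjnt (fixing_pattern n C)"
  unfolding fixing_pattern_eq pairwise_def disjnt_def using part_of_eq by blast

text \<open>The three kinds of parts are disjoint families: a free set has one-element components only, so even
  a free set with two elements is not a pair component and even a free singleton is not one of the
  singletons cut out of a large component. Hence the product of the factorials separates into the
  factors \<open>1\<close>, \<open>2 ^ p\<close> and \<open>f!\<close>; an empty free set contributes no part, in agreement with \<open>0! = 1\<close>.\<close>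

lemma card_Sym_pattern:
  "card (Sym_pattern n (fixing_pattern n C)) = 2 ^ card (pair_parts n C) * fact (card (free_set n C))"
proof -
  let ?F = "fixing_pattern n C"
  let ?S = "{{q} | q. q \<in> {1..n} \<and> card (qubit_component q) \<ge> 3}"
  let ?P = "pair_parts n C"
  let ?R = "if free_set n C = {} then {} else {free_set n C}"
  have finF: "finite ?F" by (simp add: fixing_pattern_eq)
  have F: "?F = ?S \<union> (?P \<union> ?R)" unfolding fixing_pattern_def by blast
  have fins: "finite ?S" "finite ?P" "finite ?R" using finF unfolding F by simp_all
  have PR: "?P \<inter> ?R = {}"
  proof -
    have False if "free_set n C \<in> ?P"
    proof -
      obtain q where q: "q \<in> {1..n}" "free_set n C = qubit_component q"
          "card (qubit_component q) = 2"
        using \<open>free_set n C \<in> ?P\<close> by (auto simp: pair_parts_def components_def)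
      then have "q \<in> free_set n C" using component_self[OF q(1), of "set C"] by simp
      then show False using free_set_iff[OF q(1)] q(3) by simp
    qed
    then show ?thesis by auto
  qed
  have SPR: "?S \<inter> (?P \<union> ?R) = {}"
  proof -
    have "{q} \<notin> ?P" for q by (auto simp: pair_parts_def)
    moreover have "{q} \<noteq> free_set n C" if "q \<in> {1..n}" "card (qubit_component q) \<ge> 3" for q
      using free_set_iff[OF that(1)] that(2) by auto
    ultimately show ?thesis by auto
  qed
  have "card (Sym_pattern n ?F) = card {a. a permutes \<Union>?F \<and> (\<forall>S\<in>?F. a ` S = S)}"
    by (simp add: Sym_pattern_def sym_group_carrier Union_fixing_pattern)
  also have "\<dots> = (\<Prod>S\<in>?F. fact (card S))"
  proof (rule card_permutes_preserving_parts[OF finF _ disjoint_fixing_pattern])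
    fix S assume "S \<in> ?F"
    then show "finite S"
      using Union_fixing_pattern by (metis Union_upper finite_atLeastAtMost finite_subset)
  qed
  also have "\<dots> = (\<Prod>S\<in>?S. fact (card S)) * ((\<Prod>S\<in>?P. fact (card S)) * (\<Prod>S\<in>?R. fact (card S)))"
    unfolding F using fins SPR PR by (simp only: prod.union_disjoint finite_Un simp_thms)
  also have "(\<Prod>S\<in>?S. fact (card S)) = (1::nat)"
    by (rule prod.neutral) auto
  also have "(\<Prod>S\<in>?P. fact (card S)) = (2::nat) ^ card ?P"
    by (simp add: pair_parts_def)
  also have "(\<Prod>S\<in>?R. fact (card S)) = (fact (card (free_set n C)) :: nat)"
    by simp
  finally show ?thesis by simp
qed

text \<open>The two qubits of a gate share a component. Either that component is the gate, which is then a
  part of the pattern, or it has at least three elements and both qubits are fixed pointwise.\<close>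

lemma Sym_pattern_fixes_gates:
  assumes a: "a \<in> Sym_pattern n (fixing_pattern n C)" and g: "g \<in> set C"
  shows "a ` g = g"
proof -
  obtain u v where uv: "g = {u, v}" "u \<noteq> v" "u \<in> {1..n}" "v \<in> {1..n}"
    using circuit g by (auto simp: quantum_circuit_def card_2_iff)
  have part: "a ` part_of q = part_of q" if "q \<in> {1..n}" for q
    using a that by (simp add: Sym_pattern_def fixing_pattern_eq)
  have v: "v \<in> qubit_component u"
    using uv g by (auto simp: component_def reach_def)
  have sub: "g \<subseteq> qubit_component u"
    using uv v component_self[of u "{1..n}" "set C"] by auto
  have "card g = 2" using uv by simp
  then have ge: "card (qubit_component u) \<ge> 2"
    using card_mono[OF finite_qubit_component sub] by simp
  show ?thesis
  proof (cases "card (qubit_component u) = 2")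
    case True
    then have "g = qubit_component u"
      using card_subset_eq[OF finite_qubit_component sub] \<open>card g = 2\<close> by simp
    then show ?thesis using part[OF uv(3)] True by (simp add: part_of_def)
  next
    case False
    then have "part_of u = {u}" "part_of v = {v}"
      using ge component_eq[OF v] by (simp_all add: part_of_def)
    then show ?thesis using part[OF uv(3)] part[OF uv(4)] uv(1) by simp
  qed
qed

end

section \<open>The two groups acting on permutations\<close>

lemma finite_Sym: "finite (Sym n)"
  by (simp add: sym_group_def finite_permutations)

lemma Sym_bij: "a \<in> Sym n \<Longrightarrow> bij a"
  by (simp add: sym_group_carrier permutes_bij)

lemma Sym_comp: "a \<in> Sym n \<Longrightarrow> b \<in> Sym n \<Longrightarrow> a \<circ> b \<in> Sym n"
  by (simp add: sym_group_carrier permutes_compose)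

lemma Sym_inv: "a \<in> Sym n \<Longrightarrow> inv' a \<in> Sym n"
  by (simp add: sym_group_carrier permutes_inv)

lemma inv_image_fixed: "bij a \<Longrightarrow> a ` S = S \<Longrightarrow> inv' a ` S = S"
  by (metis bij_is_inj image_inv_f_f)

lemma subgroup_Sym_pattern: "subgroup (Sym_pattern n \<F>) (sym_group n)"
proof (rule group.subgroupI[OF sym_group_is_group])
  show "Sym_pattern n \<F> \<subseteq> Sym n" by (auto simp: Sym_pattern_def)
  have "id \<in> Sym_pattern n \<F>" by (simp add: Sym_pattern_def sym_group_carrier)
  then show "Sym_pattern n \<F> \<noteq> {}" by auto
next
  fix a assume a: "a \<in> Sym_pattern n \<F>"
  then have s: "a \<in> Sym n" by (simp add: Sym_pattern_def)
  have "inv' a ` S = S" if "S \<in> \<F>" for S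
    using a that by (intro inv_image_fixed Sym_bij[OF s]) (simp add: Sym_pattern_def)
  then show "inv\<^bsub>sym_group n\<^esub> a \<in> Sym_pattern n \<F>"
    using s by (simp add: Sym_pattern_def sym_group_inv_equality Sym_inv)
next
  fix a b assume "a \<in> Sym_pattern n \<F>" "b \<in> Sym_pattern n \<F>"
  then show "a \<otimes>\<^bsub>sym_group n\<^esub> b \<in> Sym_pattern n \<F>"
    unfolding Sym_pattern_def sym_group_mult by (simp only: mem_Collect_eq Sym_comp flip: image_comp) simp
qed

lemma Sym_in_image: "a \<in> Sym n \<Longrightarrow> a x \<in> {1..n} \<longleftrightarrow> x \<in> {1..n}"
  unfolding sym_group_carrier by (rule permutes_in_image)

lemma subgroup_graph_Aut: "subgroup (graph_Aut n E) (sym_group n)"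
proof (rule group.subgroupI[OF sym_group_is_group])
  show "graph_Aut n E \<subseteq> Sym n" by (auto simp: graph_Aut_def)
  have "id \<in> graph_Aut n E" by (simp add: graph_Aut_def sym_group_carrier)
  then show "graph_Aut n E \<noteq> {}" by auto
next
  fix a assume a: "a \<in> graph_Aut n E"
  then have s: "a \<in> Sym n" by (simp add: graph_Aut_def)
  have "{u, v} \<in> E \<longleftrightarrow> {inv' a u, inv' a v} \<in> E" if "u \<in> {1..n}" "v \<in> {1..n}" for u v
  proof -
    have "inv' a u \<in> {1..n}" "inv' a v \<in> {1..n}"
      using that Sym_in_image[OF Sym_inv[OF s]] by blast+
    moreover have "a (inv' a u) = u" "a (inv' a v) = v"
      using Sym_bij[OF s] by (simp_all add: bij_is_surj surj_f_inv_f)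
    ultimately show ?thesis using a by (force simp: graph_Aut_def)
  qed
  then show "inv\<^bsub>sym_group n\<^esub> a \<in> graph_Aut n E"
    using s by (simp add: sym_group_inv_equality graph_Aut_def Sym_inv)
next
  fix a b assume a: "a \<in> graph_Aut n E" and b: "b \<in> graph_Aut n E"
  then have s: "a \<in> Sym n" "b \<in> Sym n" by (simp_all add: graph_Aut_def)
  have "{u, v} \<in> E \<longleftrightarrow> {(a \<circ> b) u, (a \<circ> b) v} \<in> E" if "u \<in> {1..n}" "v \<in> {1..n}" for u v
  proof -
    have "b u \<in> {1..n}" "b v \<in> {1..n}" using that Sym_in_image[OF s(2)] by blast+
    then have "{b u, b v} \<in> E \<longleftrightarrow> {a (b u), a (b v)} \<in> E"
      using a unfolding graph_Aut_def by blast
    moreover have "{u, v} \<in> E \<longleftrightarrow> {b u, b v} \<in> E"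
      using b that unfolding graph_Aut_def by blast
    ultimately show ?thesis by simp
  qed
  then show "a \<otimes>\<^bsub>sym_group n\<^esub> b \<in> graph_Aut n E"
    using Sym_comp[OF s] unfolding graph_Aut_def sym_group_mult by blast
qed

text \<open>With \<open>g\<close> the gate, \<open>(a \<circ> \<tau> \<circ> b\<inverse>)\<inverse>\<close> sends \<open>g\<close> to \<open>b (\<tau>\<inverse> (a\<inverse> g)) = b (\<tau>\<inverse> g)\<close>, the image of an edge under an
  automorphism.\<close>

lemma gate_alloc_closed:
  assumes circuit: "quantum_circuit n C" and k: "k \<in> {1..length C}"
    and a: "a \<in> Sym_pattern n (fixing_pattern n C)" and b: "b \<in> graph_Aut n E"
    and t: "\<tau> \<in> gate_alloc n E C k"
  shows "a \<circ> \<tau> \<circ> inv' b \<in> gate_alloc n E C k"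
proof -
  let ?g = "C ! (k - 1)"
  have g: "?g \<in> set C" using k by auto
  have S: "a \<in> Sym n" "b \<in> Sym n" "\<tau> \<in> Sym n" and tE: "inv' \<tau> ` ?g \<in> E"
    using a b t by (auto simp: Sym_pattern_def graph_Aut_def gate_alloc_def)
  note bij = Sym_bij[OF S(1)] Sym_bij[OF S(2)] Sym_bij[OF S(3)]
  have "inv' (a \<circ> \<tau> \<circ> inv' b) = b \<circ> (inv' \<tau> \<circ> inv' a)"
    using bij by (simp add: o_inv_distrib bij_comp bij_imp_bij_inv inv_inv_eq)
  then have "inv' (a \<circ> \<tau> \<circ> inv' b) ` ?g = b ` inv' \<tau> ` inv' a ` ?g"
    by (simp add: image_comp)
  also have "inv' a ` ?g = ?g"
    using Sym_pattern_fixes_gates[OF circuit a g] bij(1) by (rule inv_image_fixed[rotated])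
  finally have eq: "inv' (a \<circ> \<tau> \<circ> inv' b) ` ?g = b ` inv' \<tau> ` ?g" .
  obtain u v where uv: "?g = {u, v}" "u \<in> {1..n}" "v \<in> {1..n}"
    using circuit g by (auto simp: quantum_circuit_def card_2_iff)
  have "inv' \<tau> u \<in> {1..n}" "inv' \<tau> v \<in> {1..n}"
    using uv Sym_in_image[OF Sym_inv[OF S(3)]] by blast+
  then have "b ` inv' \<tau> ` ?g \<in> E"
    using b tE unfolding uv(1) by (simp add: graph_Aut_def)
  then show ?thesis
    unfolding gate_alloc_def mem_Collect_eq eq
    using S Sym_comp Sym_inv by blast
qed

text \<open>Cancelling \<open>\<tau>\<close> turns preservation of \<open>S\<close> by the conjugate \<open>\<tau> \<circ> b \<circ> \<tau>\<inverse>\<close> into preservation of \<open>\<tau>\<inverse> S\<close> by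
  \<open>b\<close>; this identifies the stabilizer of \<open>\<tau>\<close>.\<close>

lemma B_set_eq_conj:
  assumes t: "\<tau> \<in> Sym n"
  shows "{b \<in> graph_Aut n E. \<tau> \<circ> b \<circ> inv' \<tau> \<in> Sym_pattern n (fixing_pattern n C)} = B_set n E C \<tau>"
proof -
  have bt: "bij \<tau>" using Sym_bij[OF t] .
  have "(\<tau> \<circ> b \<circ> inv' \<tau>) ` S = S \<longleftrightarrow> b ` inv' \<tau> ` S = inv' \<tau> ` S" for b S
  proof -
    have "\<tau> ` inv' \<tau> ` S = S" "\<And>X. inv' \<tau> ` \<tau> ` X = X"
      using bt by (simp_all add: bij_is_surj bij_is_inj image_f_inv_f)
    then show ?thesis by (metis image_comp)
  qed
  moreover have "\<tau> \<circ> b \<circ> inv' \<tau> \<in> Sym n" if "b \<in> graph_Aut n E" for b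
    using that t by (simp add: graph_Aut_def Sym_comp Sym_inv)
  ultimately show ?thesis by (auto simp: B_set_def Sym_pattern_def)
qed

section \<open>From permutations to arcs\<close>

definition layer_perms :: "nat \<Rightarrow> nat set set \<Rightarrow> nat set list \<Rightarrow> nat \<Rightarrow> (nat \<Rightarrow> nat) set"
  where "layer_perms n E C k = (if k = 0 then Sym n else gate_alloc n E C k)"

definition arc :: "nat \<Rightarrow> nat \<Rightarrow> (nat \<Rightarrow> nat) \<Rightarrow> vertex \<times> vertex"
  where "arc m k \<tau> = (if k = 0 then (Source, Layer 1 \<tau>)
    else if k < m then (Layer k \<tau>, Layer (k + 1) \<tau>) else (Layer k \<tau>, Sink))"

lemma inj_arc: "inj (arc m k)"
  by (auto simp: inj_def arc_def)

lemma arc_set_eq: "arc_set n E C k = arc (length C) k ` layer_perms n E C k"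
  by (auto simp: arc_set_def arc_def layer_perms_def)

lemma layer_perms_subset: "layer_perms n E C k \<subseteq> Sym n"
  by (auto simp: layer_perms_def gate_alloc_def)

lemma layer_perms_closed:
  assumes "quantum_circuit n C" and "k \<le> length C"
    and "a \<in> Sym_pattern n (fixing_pattern n C)" and "b \<in> graph_Aut n E"
    and "\<tau> \<in> layer_perms n E C k"
  shows "a \<circ> \<tau> \<circ> inv' b \<in> layer_perms n E C k"
proof (cases "k = 0")
  case True
  then show ?thesis
    using assms by (simp add: layer_perms_def Sym_pattern_def graph_Aut_def Sym_comp Sym_inv)
next
  case False
  then show ?thesis
    using gate_alloc_closed[of n C k a b E \<tau>] assms by (simp add: layer_perms_def)
qed

lemma arc_equivariant:
  assumes \<rho>: "\<rho> Source = Source" "\<rho> Sink = Sink"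
      "\<forall>k\<in>{1..m}. \<forall>\<tau>\<in>Sym n. \<rho> (Layer k \<tau>) = Layer k (a \<circ> \<tau> \<circ> inv' b)"
    and "k \<le> m" "m \<ge> 1" "\<tau> \<in> Sym n" and arc: "arc m k \<tau> = (u, v)"
  shows "(\<rho> u, \<rho> v) = arc m k (a \<circ> \<tau> \<circ> inv' b)"
  using assms by (auto simp: arc_def split: if_splits)

text \<open>The permutation of the vertices induced by a pair \<open>(a, b)\<close>. Terms \<open>Layer k \<tau>\<close> that are not vertices are
  left alone, as the relation \<open>permutes\<close> demands.\<close>

definition layer_map :: "nat \<Rightarrow> nat \<Rightarrow> (nat \<Rightarrow> nat) \<Rightarrow> (nat \<Rightarrow> nat) \<Rightarrow> vertex \<Rightarrow> vertex"
  where "layer_map n m a b v = (case v of Source \<Rightarrow> Source | Sink \<Rightarrow> Sink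
    | Layer k \<tau> \<Rightarrow> if k \<in> {1..m} \<and> \<tau> \<in> Sym n then Layer k (a \<circ> \<tau> \<circ> inv' b) else Layer k \<tau>)"

lemma layer_map_inverse:
  assumes "a \<in> Sym n" and "b \<in> Sym n"
  shows "layer_map n m (inv' a) (inv' b) (layer_map n m a b v) = v"
proof -
  have "inv' a \<circ> (a \<circ> \<tau> \<circ> inv' b) \<circ> inv' (inv' b) = (inv' a \<circ> a) \<circ> \<tau> \<circ> (inv' b \<circ> b)" for \<tau> :: "nat \<Rightarrow> nat"
    using Sym_bij[OF assms(2)] by (simp add: inv_inv_eq comp_assoc)
  then have "inv' a \<circ> (a \<circ> \<tau> \<circ> inv' b) \<circ> inv' (inv' b) = \<tau>" for \<tau> :: "nat \<Rightarrow> nat"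
    using Sym_bij[OF assms(1)] Sym_bij[OF assms(2)] by (simp add: bij_is_inj)
  moreover have "a \<circ> \<tau> \<circ> inv' b \<in> Sym n" if "\<tau> \<in> Sym n" for \<tau>
    using that assms by (simp add: Sym_comp Sym_inv)
  ultimately show ?thesis
    by (cases v) (simp_all add: layer_map_def)
qed

lemma layer_map_permutes:
  assumes a: "a \<in> Sym n" and b: "b \<in> Sym n"
  shows "layer_map n m a b permutes vertices n m"
proof (rule bij_imp_permutes)
  have closed: "layer_map n m c d v \<in> vertices n m"
    if "c \<in> Sym n" "d \<in> Sym n" "v \<in> vertices n m" for c d v
    using that by (auto simp: layer_map_def vertices_def Sym_comp Sym_inv)
  have ii: "inv' (inv' a) = a" "inv' (inv' b) = b"
    using Sym_bij[OF a] Sym_bij[OF b] by (simp_all add: inv_inv_eq)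
  show "bij_betw (layer_map n m a b) (vertices n m) (vertices n m)"
    using closed[OF a b] closed[OF Sym_inv[OF a] Sym_inv[OF b]] layer_map_inverse[OF a b]
      layer_map_inverse[OF Sym_inv[OF a] Sym_inv[OF b]]
    by (intro bij_betwI[where g = "layer_map n m (inv' a) (inv' b)"]) (auto simp: ii)
next
  fix v assume "v \<notin> vertices n m"
  then show "layer_map n m a b v = v"
    by (auto simp: layer_map_def vertices_def split: vertex.split)
qed

lemma layer_map_in_G_X:
  assumes a: "a \<in> Sym_pattern n (fixing_pattern n C)" and b: "b \<in> graph_Aut n E"
  shows "layer_map n (length C) a b \<in> carrier (G_X n E C)"
proof -
  have "a \<in> Sym n" "b \<in> Sym n" using a b by (auto simp: Sym_pattern_def graph_Aut_def)
  then have "layer_map n (length C) a b permutes vertices n (length C)"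
    by (rule layer_map_permutes)
  then show ?thesis using a b by (auto simp: G_X_def layer_map_def)
qed

abbreviation perm_group :: "nat \<Rightarrow> nat set set \<Rightarrow> nat set list \<Rightarrow> ((nat \<Rightarrow> nat) \<times> (nat \<Rightarrow> nat)) monoid"
  where "perm_group n E C \<equiv>
    two_sided_group (sym_group n) (Sym_pattern n (fixing_pattern n C)) (graph_Aut n E)"

lemma orbit_perm_group:
  assumes "\<tau> \<in> T"
  shows "orbit (perm_group n E C) (two_sided_action (sym_group n) T) \<tau>
    = {a \<circ> \<tau> \<circ> inv' b | a b. a \<in> Sym_pattern n (fixing_pattern n C) \<and> b \<in> graph_Aut n E}"
proof -
  have "inv\<^bsub>sym_group n\<^esub> b = inv' b" if "b \<in> graph_Aut n E" for b
    using that by (simp add: graph_Aut_def sym_group_inv_equality)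
  then show ?thesis
    using assms
    by (force simp: orbit_def two_sided_group_def two_sided_action_def sym_group_mult)
qed

text \<open>Every element of the arc group acts on arcs as some pair \<open>(a, b)\<close> acts on permutations, and every pair
  arises this way, from \<open>layer_map\<close>. So the orbit of an arc is the image of the orbit of its
  permutation.\<close>

lemma orbit_G_X:
  assumes "\<tau> \<in> layer_perms n E C k" and "k \<le> length C" and "length C \<ge> 1"
  shows "orbit (G_X n E C) (arc_action (arc_set n E C k)) (arc (length C) k \<tau>)
    = arc (length C) k `
      {a \<circ> \<tau> \<circ> inv' b | a b. a \<in> Sym_pattern n (fixing_pattern n C) \<and> b \<in> graph_Aut n E}"
    (is "?L = ?R")
proof -
  obtain u v where uv: "arc (length C) k \<tau> = (u, v)" by fastforce
  have mem: "(u, v) \<in> arc_set n E C k"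
    using assms(1) unfolding arc_set_eq uv[symmetric] by blast
  have tS: "\<tau> \<in> Sym n" using assms(1) layer_perms_subset by blast
  have act: "arc_action (arc_set n E C k) \<rho> (u, v) = (\<rho> u, \<rho> v)" for \<rho>
    using mem by (simp add: arc_action_def)
  show ?thesis
  proof
    show "?L \<subseteq> ?R"
    proof
      fix x assume "x \<in> ?L"
      then obtain \<rho> where \<rho>: "\<rho> \<in> carrier (G_X n E C)" "x = (\<rho> u, \<rho> v)"
        by (auto simp: orbit_def uv act)
      then obtain a b where ab: "a \<in> Sym_pattern n (fixing_pattern n C)" "b \<in> graph_Aut n E"
        and "\<rho> Source = Source" "\<rho> Sink = Sink"
          "\<forall>k\<in>{1..length C}. \<forall>\<tau>\<in>Sym n. \<rho> (Layer k \<tau>) = Layer k (a \<circ> \<tau> \<circ> inv' b)"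
        by (auto simp: G_X_def)
      then have "x = arc (length C) k (a \<circ> \<tau> \<circ> inv' b)"
        using arc_equivariant[OF _ _ _ assms(2,3) tS uv] \<rho>(2) by blast
      then show "x \<in> ?R" using ab by blast
    qed
    show "?R \<subseteq> ?L"
    proof
      fix x assume "x \<in> ?R"
      then obtain a b where ab: "a \<in> Sym_pattern n (fixing_pattern n C)" "b \<in> graph_Aut n E"
        and x: "x = arc (length C) k (a \<circ> \<tau> \<circ> inv' b)" by blast
      let ?\<rho> = "layer_map n (length C) a b"
      have "(?\<rho> u, ?\<rho> v) = x"
        unfolding x
        by (rule arc_equivariant[OF _ _ _ assms(2,3) tS uv]) (auto simp: layer_map_def)
      then show "x \<in> ?L"
        using layer_map_in_G_X[OF ab] by (force simp: orbit_def uv act)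
    qed
  qed
qed

text \<open>The arc map is injective, so passing from orbits of permutations to their images is injective too
  and the two sets of orbits have equally many elements.\<close>

lemma card_orbitals_eq:
  assumes "k \<le> length C" and "length C \<ge> 1"
  shows "card (orbitals n E C k) = card (orbits (perm_group n E C) (layer_perms n E C k)
    (two_sided_action (sym_group n) (layer_perms n E C k)))"
proof -
  let ?O = "orbits (perm_group n E C) (layer_perms n E C k)
    (two_sided_action (sym_group n) (layer_perms n E C k))"
  have "orbitals n E C k = (\<lambda>X. arc (length C) k ` X) ` ?O"
    (is "_ = ?I ` _")
  proof -
    let ?T = "layer_perms n E C k"
    have "orbitals n E C k
        = (\<lambda>x. orbit (G_X n E C) (arc_action (arc_set n E C k)) x) ` arc_set n E C k"
      unfolding orbitals_def orbits_def by blast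
    also have "\<dots> = (\<lambda>\<tau>. orbit (G_X n E C) (arc_action (arc_set n E C k)) (arc (length C) k \<tau>)) ` ?T"
      by (subst (2) arc_set_eq) (simp only: image_image)
    also have "\<dots> = (\<lambda>\<tau>. ?I (orbit (perm_group n E C) (two_sided_action (sym_group n) ?T) \<tau>)) ` ?T"
      using orbit_G_X[OF _ assms] by (intro image_cong) (simp_all add: orbit_perm_group)
    also have "\<dots> = ?I ` ?O"
      unfolding orbits_def by blast
    finally show ?thesis .
  qed
  moreover have "inj_on (\<lambda>X. arc (length C) k ` X) ?O"
    using inj_arc by (auto simp: inj_on_def inj_image_eq_iff)
  ultimately show ?thesis by (simp add: card_image)
qed

lemma card_orbitals_formula:
  assumes circuit: "quantum_circuit n C" and k: "k \<le> length C" and C: "length C \<ge> 1"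
  shows "real (card (orbitals n E C k)) = (\<Sum>\<tau>\<in>layer_perms n E C k. real (card (B_set n E C \<tau>)))
    / (2 ^ card (pair_parts n C) * fact (card (free_set n C)) * real (card (graph_Aut n E)))"
proof -
  let ?K = "Sym_pattern n (fixing_pattern n C)" and ?L = "graph_Aut n E"
  let ?T = "layer_perms n E C k" and ?G = "sym_group n"
  interpret S: group ?G by (rule sym_group_is_group)
  note sub = subgroup_Sym_pattern[of n "fixing_pattern n C"] subgroup_graph_Aut[of n E]
  have fin: "finite ?K" "finite ?L" "finite ?T"
    using finite_Sym layer_perms_subset subgroup.subset[OF sub(1)] subgroup.subset[OF sub(2)]
    by (meson finite_subset)+
  have closed: "a \<otimes>\<^bsub>?G\<^esub> t \<otimes>\<^bsub>?G\<^esub> inv\<^bsub>?G\<^esub> b \<in> ?T" if "a \<in> ?K" "b \<in> ?L" "t \<in> ?T" for a b t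
    using layer_perms_closed[OF circuit k that] subgroup.mem_carrier[OF sub(2) that(2)]
    by (simp add: sym_group_mult sym_group_inv_equality)
  have "card (orbitals n E C k) * (card ?K * card ?L)
      = (\<Sum>t\<in>?T. card {b \<in> ?L. t \<otimes>\<^bsub>?G\<^esub> b \<otimes>\<^bsub>?G\<^esub> inv\<^bsub>?G\<^esub> t \<in> ?K})"
    unfolding card_orbitals_eq[OF k C]
    by (rule S.card_two_sided_orbits[OF sub layer_perms_subset closed fin])
  also have "\<dots> = (\<Sum>t\<in>?T. card (B_set n E C t))"
  proof (rule sum.cong[OF refl])
    fix t assume "t \<in> ?T"
    then have "t \<in> Sym n" using layer_perms_subset by blast
    then show "card {b \<in> ?L. t \<otimes>\<^bsub>?G\<^esub> b \<otimes>\<^bsub>?G\<^esub> inv\<^bsub>?G\<^esub> t \<in> ?K} = card (B_set n E C t)"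
      using B_set_eq_conj[of t n E C] by (simp add: sym_group_mult sym_group_inv_equality)
  qed
  finally have eq: "card (orbitals n E C k) * (card ?K * card ?L) = (\<Sum>t\<in>?T. card (B_set n E C t))" .
  have "card ?L > 0" using fin(2) subgroup.one_closed[OF sub(2)] by (auto simp: card_gt_0_iff)
  moreover have "real (card (orbitals n E C k)) * (2 ^ card (pair_parts n C)
      * fact (card (free_set n C)) * real (card ?L)) = (\<Sum>t\<in>?T. real (card (B_set n E C t)))"
    using arg_cong[OF eq, of real] by (simp add: card_Sym_pattern[OF circuit])
  ultimately show ?thesis by (simp add: field_simps)
qed

theorem theorem3p11:
  fixes n m p f :: nat and E :: "nat set set" and C :: "nat set list"
  assumes "n \<ge> 3"
    and "connected_graph {1..n} E"
    and "quantum_circuit n C"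
    and "m = length C" and "m \<ge> 1"
    and "p = card (pair_parts n C)"
    and "f = card (free_set n C)"
  shows "real (card (orbitals n E C 0)) =
           (\<Sum>\<tau>\<in>Sym n. real (card (B_set n E C \<tau>)))
             / (2 ^ p * fact f * real (card (graph_Aut n E)))
       \<and> (\<forall>k\<in>{1..m}. real (card (orbitals n E C k)) =
           (\<Sum>\<tau>\<in>gate_alloc n E C k. real (card (B_set n E C \<tau>)))
             / (2 ^ p * fact f * real (card (graph_Aut n E))))"
proof (intro conjI ballI)
  show "real (card (orbitals n E C 0)) = (\<Sum>\<tau>\<in>Sym n. real (card (B_set n E C \<tau>)))
      / (2 ^ p * fact f * real (card (graph_Aut n E)))"
    using card_orbitals_formula[of n C 0 E] assms by (simp add: layer_perms_def)
next
  fix k assume "k \<in> {1..m}"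
  then show "real (card (orbitals n E C k)) =
      (\<Sum>\<tau>\<in>gate_alloc n E C k. real (card (B_set n E C \<tau>)))
      / (2 ^ p * fact f * real (card (graph_Aut n E)))"
    using card_orbitals_formula[of n C k E] assms by (simp add: layer_perms_def)
qed

end
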